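(* Let $G$ be a countable infinite discrete amenable group acting continuously on a compact metric space $(X,d)$, and let $\{F_n\}_{n=1}^{\infty}$ be a Følner sequence in $G$ with $|F_n|$ increasing and $|F_n|\to\infty$. Let $\Phi:X\to\mathbb{R}$ be a positive continuous function and $\mu\in M(X)$. Then $$\dim_{\mu}^{\widetilde{BSP}}(\{F_n\}_{n=1}^{\infty},\Phi)=\dim_{\mu}^{\widetilde{KP}}(\{F_n\}_{n=1}^{\infty},\Phi)=\inf\left\{\dim_H^{\widetilde{BSP}}(\{F_n\}_{n=1}^{\infty},\Phi):H\subset X\text{ Borel},\ \mu(H)=1\right\}.$$
   Context: A Følner sequence in $G$ is a sequence of non-empty finite subsets $F_n\subset G$ with $\lim_{n\to\infty}|F_n\triangle gF_n|/|F_n|=0$ for every $g\in G$. $M(X)$ is the set of Borel probability measures on $X$. For finite $F\subset G$: $d_F(x,y)=\max_{g\in F}d(gx,gy)$, $\overline B_F(x,\epsilon)=\{y:d_F(x,y)\le\epsilon\}$, and $\Phi_F(x)=\sum_{g\in F}\Phi(gx)$. All quantities take values in $[0,\infty]$; in critical values below $s$ ranges over $s>0$, with $\sup\emptyset=0$, $\inf\emptyset=\infty$. BS packing dimension of a set. For $H\subset X$, $\epsilon>0$, $N\in\mathbb{N}$, $s>0$ let $$L^{s}_{N,\epsilon}(H,\{F_n\},\Phi)=\sup\sum_{i\in I}\exp\Big(-s\sup_{y\in\overline B_{F_{n_i}}(x_i,\epsilon)}\Phi_{F_{n_i}}(y)\Big),$$ the supremum over all finite or countable pairwise disjoint families $\{\overline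 B_{F_{n_i}}(x_i,\epsilon)\}_{i\in I}$ with $n_i\ge N$, $x_i\in H$. Let $L^s_\epsilon(H,\{F_n\},\Phi)=\lim_{N\to\infty}L^s_{N,\epsilon}(H,\{F_n\},\Phi)$, $\mathscr L^s_\epsilon(H,\{F_n\},\Phi)=\inf\{\sum_{i=1}^\infty L^s_\epsilon(H_i,\{F_n\},\Phi):H\subset\bigcup_{i=1}^\infty H_i\}$, $\mathscr L_\epsilon(H,\{F_n\},\Phi)=\sup\{s:\mathscr L^s_\epsilon=\infty\}=\inf\{s:\mathscr L^s_\epsilon=0\}$, and $\dim_H^{\widetilde{BSP}}(\{F_n\},\Phi)=\lim_{\epsilon\to0}\mathscr L_\epsilon(H,\{F_n\},\Phi)$. Let $\widetilde L^s_{N,\epsilon}$, $\widetilde L^s_\epsilon$, $\widetilde{\mathscr L}^s_\epsilon$, $\widetilde{\mathscr L}_\epsilon$ be defined in the same way with $\sup_{y\in\overline B_{F_{n_i}}(x_i,\epsilon)}\Phi_{F_{n_i}}(y)$ replaced by $\Phi_{F_{n_i}}(x_i)$. BS packing dimension of $\mu$: $\dim_\mu^{\widetilde{BSP}}(\{F_n\},\Phi)=\lim_{\epsilon\to0}\lim_{\delta\to0}\inf\{\widetilde{\mathscr L}_\epsilon(H,\{F_n\},\Phi):H\subset X\text{ Borel},\ \mu(H)\ge1-\delta\}$. BS packing dimension of $\mu$ in the sense of Katok: for $\delta\in(0,1)$ let $\Xi^s_\epsilon(\mu,\{F_n\},\Phi,\delta)=\inf\{\sum_{i=1}^\infty\widetilde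 L^s_\epsilon(H_i,\{F_n\},\Phi):\mu(\bigcup_{i=1}^\infty H_i)\ge1-\delta\}$ (over countable families of subsets of $X$ whose union is Borel), $\Xi_\epsilon(\mu,\{F_n\},\Phi,\delta)=\sup\{s:\Xi^s_\epsilon(\mu,\{F_n\},\Phi,\delta)=+\infty\}$, and $\dim_\mu^{\widetilde{KP}}(\{F_n\},\Phi)=\lim_{\epsilon\to0}\lim_{\delta\to0}\Xi_\epsilon(\mu,\{F_n\},\Phi,\delta)$. *)

theory Defs
  imports "HOL-Probability.Probability" "HOL-Algebra.Group_Action"
begin

text \<open>Amenability of a discrete group: a left-invariant finitely additive probability measure
  on all subsets of the group.\<close>

definition amenable :: "('g, 'm) monoid_scheme \<Rightarrow> bool" where
  "amenable G \<longleftrightarrow>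
     (\<exists>m :: 'g set \<Rightarrow> real.
        m (carrier G) = 1 \<and>
        (\<forall>A. A \<subseteq> carrier G \<longrightarrow> 0 \<le> m A) \<and>
        (\<forall>A B. A \<subseteq> carrier G \<longrightarrow> B \<subseteq> carrier G \<longrightarrow> A \<inter> B = {} \<longrightarrow>
           m (A \<union> B) = m A + m B) \<and>
        (\<forall>g\<in>carrier G. \<forall>A. A \<subseteq> carrier G \<longrightarrow> m (g <#\<^bsub>G\<^esub> A) = m A))"

text \<open>Sequences are indexed by all of \<open>nat\<close>, so the first member of the sequence is \<open>F 0\<close>.\<close>

definition Folner_sequence :: "('g, 'm) monoid_scheme \<Rightarrow> (nat \<Rightarrow> 'g set) \<Rightarrow> bool" where
  "Folner_sequence G F \<longleftrightarrow>
     (\<forall>n. finite (F n) \<and> F n \<noteq> {} \<and> F n \<subseteq> carrier G) \<and>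
     (\<forall>g\<in>carrier G.
        (\<lambda>n. real (card (sym_diff (F n) (g <#\<^bsub>G\<^esub> F n))) / real (card (F n)))
          \<longlonglongrightarrow> 0)"

definition dist_along :: "('g \<Rightarrow> 'x::metric_space \<Rightarrow> 'x) \<Rightarrow> 'g set \<Rightarrow> 'x \<Rightarrow> 'x \<Rightarrow> real" where
  "dist_along act E x y = Max ((\<lambda>g. dist (act g x) (act g y)) ` E)"

definition cball_along :: "('g \<Rightarrow> 'x::metric_space \<Rightarrow> 'x) \<Rightarrow> 'g set \<Rightarrow> 'x \<Rightarrow> real \<Rightarrow> 'x set" where
  "cball_along act E x \<epsilon> = {y. dist_along act E x y \<le> \<epsilon>}"

definition sum_along :: "('g \<Rightarrow> 'x \<Rightarrow> 'x) \<Rightarrow> ('x \<Rightarrow> real) \<Rightarrow> 'g set \<Rightarrow> 'x \<Rightarrow> real" where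
  "sum_along act \<Phi> E x = (\<Sum>g\<in>E. \<Phi> (act g x))"

text \<open>The two versions of the packing quantities differ only in the weight attached to a ball:
  either the supremum of the Birkhoff sum over the ball, or (the tilde version) its value at the
  centre. The construction below takes the weight \<open>w \<epsilon> n x\<close> of the ball of radius \<open>\<epsilon>\<close> along
  \<open>F n\<close> centred at \<open>x\<close> as a parameter.\<close>

definition sup_weight ::
  "('g \<Rightarrow> 'x::metric_space \<Rightarrow> 'x) \<Rightarrow> (nat \<Rightarrow> 'g set) \<Rightarrow> ('x \<Rightarrow> real) \<Rightarrow> real \<Rightarrow> nat \<Rightarrow> 'x \<Rightarrow> real"
  where
  "sup_weight act F \<Phi> \<epsilon> n x = (SUP y\<in>cball_along act (F n) x \<epsilon>. sum_along act \<Phi> (F n) y)"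

definition centre_weight ::
  "('g \<Rightarrow> 'x::metric_space \<Rightarrow> 'x) \<Rightarrow> (nat \<Rightarrow> 'g set) \<Rightarrow> ('x \<Rightarrow> real) \<Rightarrow> real \<Rightarrow> nat \<Rightarrow> 'x \<Rightarrow> real"
  where
  "centre_weight act F \<Phi> \<epsilon> n x = sum_along act \<Phi> (F n) x"

text \<open>Finite or countable families are indexed by arbitrary subsets \<open>I\<close> of \<open>nat\<close>; the empty
  family is allowed.\<close>

definition packing_pre ::
  "('g \<Rightarrow> 'x::metric_space \<Rightarrow> 'x) \<Rightarrow> (nat \<Rightarrow> 'g set) \<Rightarrow> (real \<Rightarrow> nat \<Rightarrow> 'x \<Rightarrow> real) \<Rightarrow>
     real \<Rightarrow> nat \<Rightarrow> real \<Rightarrow> 'x set \<Rightarrow> ennreal" where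
  "packing_pre act F w s N \<epsilon> H =
     Sup {(\<Sum>\<^sub>\<infinity>i\<in>I. ennreal (exp (- s * w \<epsilon> (n i) (x i)))) | (I :: nat set) n x.
            (\<forall>i\<in>I. N \<le> n i \<and> x i \<in> H) \<and>
            disjoint_family_on (\<lambda>i. cball_along act (F (n i)) (x i) \<epsilon>) I}"

definition packing_lim ::
  "('g \<Rightarrow> 'x::metric_space \<Rightarrow> 'x) \<Rightarrow> (nat \<Rightarrow> 'g set) \<Rightarrow> (real \<Rightarrow> nat \<Rightarrow> 'x \<Rightarrow> real) \<Rightarrow>
     real \<Rightarrow> real \<Rightarrow> 'x set \<Rightarrow> ennreal" where
  "packing_lim act F w s \<epsilon> H = lim (\<lambda>N. packing_pre act F w s N \<epsilon> H)"

definition packing_outer ::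
  "('g \<Rightarrow> 'x::metric_space \<Rightarrow> 'x) \<Rightarrow> (nat \<Rightarrow> 'g set) \<Rightarrow> (real \<Rightarrow> nat \<Rightarrow> 'x \<Rightarrow> real) \<Rightarrow>
     real \<Rightarrow> real \<Rightarrow> 'x set \<Rightarrow> ennreal" where
  "packing_outer act F w s \<epsilon> H =
     Inf {(\<Sum>i. packing_lim act F w s \<epsilon> (K i)) | K :: nat \<Rightarrow> 'x set. H \<subseteq> (\<Union>i. K i)}"

definition packing_crit ::
  "('g \<Rightarrow> 'x::metric_space \<Rightarrow> 'x) \<Rightarrow> (nat \<Rightarrow> 'g set) \<Rightarrow> (real \<Rightarrow> nat \<Rightarrow> 'x \<Rightarrow> real) \<Rightarrow>
     real \<Rightarrow> 'x set \<Rightarrow> ennreal" where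
  "packing_crit act F w \<epsilon> H = Sup {ennreal s | s. 0 < s \<and> packing_outer act F w s \<epsilon> H = \<infinity>}"

definition BSP_dim_set ::
  "('g \<Rightarrow> 'x::metric_space \<Rightarrow> 'x) \<Rightarrow> (nat \<Rightarrow> 'g set) \<Rightarrow> ('x \<Rightarrow> real) \<Rightarrow> 'x set \<Rightarrow> ennreal" where
  "BSP_dim_set act F \<Phi> H =
     Lim (at_right 0) (\<lambda>\<epsilon>. packing_crit act F (sup_weight act F \<Phi>) \<epsilon> H)"

definition BSP_dim_measure ::
  "('g \<Rightarrow> 'x::metric_space \<Rightarrow> 'x) \<Rightarrow> (nat \<Rightarrow> 'g set) \<Rightarrow> ('x \<Rightarrow> real) \<Rightarrow> 'x measure \<Rightarrow> ennreal" where
  "BSP_dim_measure act F \<Phi> \<mu> =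
     Lim (at_right 0) (\<lambda>\<epsilon>. Lim (at_right 0) (\<lambda>\<delta>.
       Inf {packing_crit act F (centre_weight act F \<Phi>) \<epsilon> H | H.
              H \<in> sets borel \<and> 1 - \<delta> \<le> measure \<mu> H}))"

definition Katok_outer ::
  "('g \<Rightarrow> 'x::metric_space \<Rightarrow> 'x) \<Rightarrow> (nat \<Rightarrow> 'g set) \<Rightarrow> ('x \<Rightarrow> real) \<Rightarrow> 'x measure \<Rightarrow>
     real \<Rightarrow> real \<Rightarrow> real \<Rightarrow> ennreal" where
  "Katok_outer act F \<Phi> \<mu> s \<epsilon> \<delta> =
     Inf {(\<Sum>i. packing_lim act F (centre_weight act F \<Phi>) s \<epsilon> (K i)) | K :: nat \<Rightarrow> 'x set.
            (\<Union>i. K i) \<in> sets borel \<and> 1 - \<delta> \<le> measure \<mu> (\<Union>i. K i)}"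

definition Katok_crit ::
  "('g \<Rightarrow> 'x::metric_space \<Rightarrow> 'x) \<Rightarrow> (nat \<Rightarrow> 'g set) \<Rightarrow> ('x \<Rightarrow> real) \<Rightarrow> 'x measure \<Rightarrow>
     real \<Rightarrow> real \<Rightarrow> ennreal" where
  "Katok_crit act F \<Phi> \<mu> \<epsilon> \<delta> = Sup {ennreal s | s. 0 < s \<and> Katok_outer act F \<Phi> \<mu> s \<epsilon> \<delta> = \<infinity>}"

definition KP_dim_measure ::
  "('g \<Rightarrow> 'x::metric_space \<Rightarrow> 'x) \<Rightarrow> (nat \<Rightarrow> 'g set) \<Rightarrow> ('x \<Rightarrow> real) \<Rightarrow> 'x measure \<Rightarrow> ennreal" where
  "KP_dim_measure act F \<Phi> \<mu> =
     Lim (at_right 0) (\<lambda>\<epsilon>. Lim (at_right 0) (\<lambda>\<delta>. Katok_crit act F \<Phi> \<mu> \<epsilon> \<delta>))"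

end

theory Submission
  imports Defs
begin

text \<open>
  As the radius \<open>\<epsilon>\<close> or the defect \<open>\<delta>\<close> decreases, all critical values grow, so every limit in the
  three dimensions is a supremum; this also gives meaning to the limits.

  For a single set \<open>H\<close>, the weights by the supremum over a ball and by the value at the centre
  lead to the same dimension (\<open>BSP_dim_set_eq_centre\<close>): the potential is uniformly continuous and
  bounded away from \<open>0\<close>, so on small balls the two weights agree up to a factor \<open>1 + \<eta>\<close>, and so do
  the critical values. From here on only centre weights matter.

  The quantities for \<open>\<mu>\<close> are then compared in a circle. The Katok dimension is at most the packing
  dimension of \<open>\<mu>\<close>, since a cover of a Borel set of measure at least \<open>1 - \<delta>\<close>, once intersected with
  that set, is one of the families that the Katok quantity admits; the packing dimension of \<open>\<mu>\<close> is at most the dimension of any set of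
  full measure, since such a set competes for every \<open>\<delta>\<close>. It remains to find sets of full measure
  whose dimension hardly exceeds the Katok dimension
  (\<open>exists_full_measure_set_above_KP_dim\<close>). Let \<open>s\<close> lie above the latter and let \<open>t > s\<close>. For all
  \<open>\<epsilon>\<close> and \<open>\<delta>\<close> there is a countable family of sets \<open>K i\<close> of finite \<open>s\<close>-quantity that covers measure
  \<open>1 - \<delta>\<close>. Because \<open>|F n|\<close> tends to infinity, the \<open>t\<close>-quantity of each \<open>K i\<close> vanishes
  (\<open>packing_lim_centre_eq_0\<close>). Vanishing, unlike finiteness, survives the countable union over
  \<open>\<delta> = 1, 1/2, 1/3, ...\<close>, and monotonicity in \<open>\<epsilon>\<close> allows the resulting sets to be intersected over
  \<open>\<epsilon> = 1, 1/2, 1/3, ...\<close>, which yields one set of full measure and dimension at most \<open>t\<close>.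
\<close>

section \<open>Limits in the extended half-line\<close>

lemma Lim_at_right_antimono:
  fixes f :: "real \<Rightarrow> ennreal"
  assumes "\<And>a b. 0 < a \<Longrightarrow> a \<le> b \<Longrightarrow> f b \<le> f a"
  shows "Lim (at_right 0) f = (SUP e\<in>{0<..}. f e)"
proof (rule tendsto_Lim)
  show "(f \<longlongrightarrow> (SUP e\<in>{0<..}. f e)) (at_right 0)"
  proof (rule order_tendstoI)
    fix a assume "a < (SUP e\<in>{0<..}. f e)"
    then obtain e where e: "0 < e" "a < f e" by (auto simp: less_SUP_iff)
    have "\<forall>\<^sub>F x in at_right 0. x \<in> {0<..<e}"
      using e(1) by (rule eventually_at_right_real)
    then show "\<forall>\<^sub>F x in at_right 0. a < f x"
      by eventually_elim (use e assms in \<open>auto intro: less_le_trans less_imp_le\<close>)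
  next
    fix a assume a: "(SUP e\<in>{0<..}. f e) < a"
    have "\<forall>\<^sub>F x in at_right (0::real). x \<in> {0<..<1}"
      by (rule eventually_at_right_real) simp
    then show "\<forall>\<^sub>F x in at_right 0. f x < a"
    proof eventually_elim
      fix x :: real assume "x \<in> {0<..<1}"
      then have "f x \<le> (SUP e\<in>{0<..}. f e)" by (intro SUP_upper) auto
      then show "f x < a" using a by (rule le_less_trans)
    qed
  qed
qed simp

lemma ennreal_le_if_le_all_multiples:
  fixes x y :: ennreal
  assumes le: "\<And>\<eta>. 0 < \<eta> \<Longrightarrow> x \<le> ennreal (1 + \<eta>) * y"
  shows "x \<le> y"
proof (cases y)
  case (real r)
  have "x \<le> ennreal r"
  proof (rule ennreal_le_epsilon)
    fix e :: real assume e: "0 < e"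
    have "x \<le> ennreal (1 + e / (r + 1)) * y"
      using e real by (intro le) (auto intro: divide_pos_pos)
    also have "\<dots> = ennreal ((1 + e / (r + 1)) * r)"
      using e real by (simp add: ennreal_mult)
    also have "\<dots> \<le> ennreal (r + e)"
    proof (rule ennreal_leI)
      have "e * r \<le> e * (r + 1)" using e by simp
      then show "(1 + e / (r + 1)) * r \<le> r + e"
        using real by (simp add: field_simps)
    qed
    also have "\<dots> = ennreal r + ennreal e" using e real by (simp add: ennreal_plus)
    finally show "x \<le> ennreal r + ennreal e" .
  qed
  then show ?thesis using real by simp
qed simp

text \<open>Multiplication on \<^typ>\<open>ennreal\<close> is not jointly continuous, which rules out the usual proof by
  passing to the limit in the finite partial sums; nonnegativity makes the sum a supremum instead.\<close>

lemma infsum_cmult_le_ennreal: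
  fixes f :: "'a \<Rightarrow> ennreal"
  shows "(\<Sum>\<^sub>\<infinity>i\<in>I. c * f i) \<le> c * (\<Sum>\<^sub>\<infinity>i\<in>I. f i)"
proof -
  have "(\<Sum>\<^sub>\<infinity>i\<in>I. c * f i) = (SUP J\<in>{J. finite J \<and> J \<subseteq> I}. \<Sum>i\<in>J. c * f i)"
    by (rule nonneg_infsum_complete) simp
  also have "\<dots> \<le> c * (\<Sum>\<^sub>\<infinity>i\<in>I. f i)"
  proof (rule SUP_least)
    fix J assume J: "J \<in> {J. finite J \<and> J \<subseteq> I}"
    have "(\<Sum>\<^sub>\<infinity>i\<in>I. f i) = (SUP J\<in>{J. finite J \<and> J \<subseteq> I}. \<Sum>i\<in>J. f i)"
      by (rule nonneg_infsum_complete) simp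
    then have "(\<Sum>i\<in>J. f i) \<le> (\<Sum>\<^sub>\<infinity>i\<in>I. f i)"
      using J by (simp add: SUP_upper)
    then show "(\<Sum>i\<in>J. c * f i) \<le> c * (\<Sum>\<^sub>\<infinity>i\<in>I. f i)"
      by (simp add: sum_distrib_left[symmetric] mult_left_mono)
  qed
  finally show ?thesis .
qed

section \<open>Comparison of packing quantities\<close>

lemma cball_along_mono: "\<epsilon>' \<le> \<epsilon> \<Longrightarrow> cball_along act E x \<epsilon>' \<subseteq> cball_along act E x \<epsilon>"
  by (auto simp: cball_along_def)

text \<open>A packing by balls of radius \<open>\<epsilon>\<close> centred in \<open>H\<close> remains one when the radius shrinks,
  the admissible set of centres grows or the lower bound on the indices drops. Hence a single
  inequality between the exponents settles every comparison of packing quantities.\<close>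

lemma packing_pre_mono:
  assumes "H \<subseteq> H'" "\<epsilon>' \<le> \<epsilon>" "N' \<le> N"
    and "\<And>n x. s' * w' \<epsilon>' n x \<le> s * w \<epsilon> n x"
  shows "packing_pre act F w s N \<epsilon> H \<le> packing_pre act F w' s' N' \<epsilon>' H'"
  unfolding packing_pre_def
proof (rule Sup_least, clarify)
  fix I :: "nat set" and n x
  assume cen: "\<forall>i\<in>I. N \<le> n i \<and> x i \<in> H"
    and disj: "disjoint_family_on (\<lambda>i. cball_along act (F (n i)) (x i) \<epsilon>) I"
  have "disjoint_family_on (\<lambda>i. cball_along act (F (n i)) (x i) \<epsilon>') I"
    using disj cball_along_mono[OF assms(2)] unfolding disjoint_family_on_def by blast
  moreover have "\<forall>i\<in>I. N' \<le> n i \<and> x i \<in> H'"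
    using cen assms(1,3) by (meson order_trans subsetD)
  moreover have "(\<Sum>\<^sub>\<infinity>i\<in>I. ennreal (exp (- s * w \<epsilon> (n i) (x i))))
      \<le> (\<Sum>\<^sub>\<infinity>i\<in>I. ennreal (exp (- s' * w' \<epsilon>' (n i) (x i))))"
    by (intro infsum_mono ennreal_leI nonneg_summable_on_complete) (use assms(4) in auto)
  ultimately show "(\<Sum>\<^sub>\<infinity>i\<in>I. ennreal (exp (- s * w \<epsilon> (n i) (x i))))
      \<le> Sup {(\<Sum>\<^sub>\<infinity>i\<in>I. ennreal (exp (- s' * w' \<epsilon>' (n i) (x i)))) | (I :: nat set) n x.
            (\<forall>i\<in>I. N' \<le> n i \<and> x i \<in> H') \<and>
            disjoint_family_on (\<lambda>i. cball_along act (F (n i)) (x i) \<epsilon>') I}"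
    by (intro Sup_upper2[of "\<Sum>\<^sub>\<infinity>i\<in>I. ennreal (exp (- s' * w' \<epsilon>' (n i) (x i)))"]) auto
qed

lemma packing_lim_eq_INF: "packing_lim act F w s \<epsilon> H = (INF N. packing_pre act F w s N \<epsilon> H)"
  unfolding packing_lim_def
  by (intro limI LIMSEQ_INF decseq_SucI packing_pre_mono) auto

lemma packing_lim_mono:
  assumes "H \<subseteq> H'" "\<epsilon>' \<le> \<epsilon>" and "\<And>n x. s' * w' \<epsilon>' n x \<le> s * w \<epsilon> n x"
  shows "packing_lim act F w s \<epsilon> H \<le> packing_lim act F w' s' \<epsilon>' H'"
  unfolding packing_lim_eq_INF by (intro INF_mono' packing_pre_mono assms order_refl)

lemma packing_outer_mono:
  assumes "H \<subseteq> H'" "\<epsilon>' \<le> \<epsilon>" and "\<And>n x. s' * w' \<epsilon>' n x \<le> s * w \<epsilon> n x"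
  shows "packing_outer act F w s \<epsilon> H \<le> packing_outer act F w' s' \<epsilon>' H'"
  unfolding packing_outer_def
proof (rule Inf_greatest, clarify)
  fix K :: "nat \<Rightarrow> 'a set" assume K: "H' \<subseteq> (\<Union>i. K i)"
  have "Inf {(\<Sum>i. packing_lim act F w s \<epsilon> (K i)) | K. H \<subseteq> (\<Union>i. K i)}
      \<le> (\<Sum>i. packing_lim act F w s \<epsilon> (K i))"
    by (rule Inf_lower) (use K assms(1) in blast)
  also have "\<dots> \<le> (\<Sum>i. packing_lim act F w' s' \<epsilon>' (K i))"
    by (intro suminf_le packing_lim_mono assms) auto
  finally show "Inf {(\<Sum>i. packing_lim act F w s \<epsilon> (K i)) | K. H \<subseteq> (\<Union>i. K i)}
      \<le> (\<Sum>i. packing_lim act F w' s' \<epsilon>' (K i))" .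
qed

lemma packing_crit_mono:
  assumes "H \<subseteq> H'" "\<epsilon>' \<le> \<epsilon>" and "\<And>n x. w' \<epsilon>' n x \<le> w \<epsilon> n x"
  shows "packing_crit act F w \<epsilon> H \<le> packing_crit act F w' \<epsilon>' H'"
  unfolding packing_crit_def
proof (rule Sup_subset_mono, clarify)
  fix s :: real assume s: "0 < s" "packing_outer act F w s \<epsilon> H = \<infinity>"
  have "packing_outer act F w s \<epsilon> H \<le> packing_outer act F w' s \<epsilon>' H'"
    by (intro packing_outer_mono assms mult_left_mono) (use s in auto)
  then show "\<exists>t. ennreal s = ennreal t \<and> 0 < t \<and> packing_outer act F w' t \<epsilon>' H' = \<infinity>"
    using s by (intro exI[of _ s]) (simp add: top_unique)
qed

section \<open>Weights of a positive potential\<close>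

locale positive_potential =
  fixes act :: "'g \<Rightarrow> 'x::metric_space \<Rightarrow> 'x"
    and F :: "nat \<Rightarrow> 'g set"
    and \<Phi> :: "'x \<Rightarrow> real"
  assumes compact_space: "compact (UNIV :: 'x set)"
    and finite_F: "finite (F n)" and F_nonempty: "F n \<noteq> {}"
    and card_unbounded: "filterlim (\<lambda>n. card (F n)) at_top sequentially"
    and potential_continuous: "continuous_on UNIV \<Phi>"
    and potential_pos: "0 < \<Phi> x"
begin

abbreviation "centre \<equiv> centre_weight act F \<Phi>"
abbreviation "supw \<equiv> sup_weight act F \<Phi>"

lemma potential_lower_bound: obtains m where "0 < m" "\<And>x. m \<le> \<Phi> x"
proof -
  obtain x where "\<And>y. \<Phi> x \<le> \<Phi> y"
    using continuous_attains_inf[OF compact_space _ potential_continuous] by auto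
  then show ?thesis using that potential_pos by blast
qed

lemma sum_along_ge: "(\<And>x. m \<le> \<Phi> x) \<Longrightarrow> m * real (card (F n)) \<le> sum_along act \<Phi> (F n) x"
  using sum_bounded_below[of "F n" m "\<lambda>g. \<Phi> (act g x)"]
  by (simp add: sum_along_def mult.commute)

lemma centre_nonneg: "0 \<le> centre \<epsilon> n x"
  unfolding centre_weight_def sum_along_def
  by (intro sum_nonneg) (simp add: potential_pos less_imp_le)

lemma bdd_above_sum_along: "bdd_above (sum_along act \<Phi> (F n) ` A)"
proof -
  obtain z where z: "\<And>y. \<Phi> y \<le> \<Phi> z"
    using continuous_attains_sup[OF compact_space _ potential_continuous] by auto
  show ?thesis
    unfolding sum_along_def
    by (rule bdd_aboveI2[where M = "\<Sum>g\<in>F n. \<Phi> z"]) (intro sum_mono z)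
qed

lemma centre_in_cball_along: "0 < \<epsilon> \<Longrightarrow> x \<in> cball_along act (F n) x \<epsilon>"
  using finite_F[of n] F_nonempty[of n] by (simp add: cball_along_def dist_along_def)

lemma centre_le_supw: "0 < \<epsilon> \<Longrightarrow> centre \<epsilon> n x \<le> supw \<epsilon> n x"
  unfolding centre_weight_def sup_weight_def
  by (rule cSUP_upper[OF centre_in_cball_along bdd_above_sum_along])

lemma supw_mono: "0 < \<epsilon>' \<Longrightarrow> \<epsilon>' \<le> \<epsilon> \<Longrightarrow> supw \<epsilon>' n x \<le> supw \<epsilon> n x"
  unfolding sup_weight_def using centre_in_cball_along
  by (intro cSUP_subset_mono bdd_above_sum_along cball_along_mono) auto

text \<open>For small radii the two weights differ by a factor close to \<open>1\<close>: uniform continuity makes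
  the variation of the Birkhoff sum over a ball at most \<open>\<eta> m\<close> per group element, where \<open>m\<close> is a
  lower bound of the potential, and this is at most \<open>\<eta>\<close> times the Birkhoff sum itself.\<close>

lemma supw_le_centre:
  assumes "0 < \<eta>"
  obtains \<epsilon>\<^sub>0 where "0 < \<epsilon>\<^sub>0"
    "\<And>\<epsilon> n x. 0 < \<epsilon> \<Longrightarrow> \<epsilon> \<le> \<epsilon>\<^sub>0 \<Longrightarrow> supw \<epsilon> n x \<le> (1 + \<eta>) * centre \<epsilon> n x"
proof -
  obtain m where m: "0 < m" "\<And>x. m \<le> \<Phi> x" by (rule potential_lower_bound) auto
  have "uniformly_continuous_on UNIV \<Phi>"
    by (rule compact_uniformly_continuous[OF potential_continuous compact_space])
  moreover have "0 < \<eta> * m" using assms m by simp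
  ultimately obtain d where d: "0 < d" "\<And>x y. dist y x < d \<Longrightarrow> dist (\<Phi> y) (\<Phi> x) < \<eta> * m"
    unfolding uniformly_continuous_on_def by (metis UNIV_I)
  have "supw \<epsilon> n x \<le> (1 + \<eta>) * centre \<epsilon> n x" if e: "0 < \<epsilon>" "\<epsilon> \<le> d / 2" for \<epsilon> n x
    unfolding sup_weight_def
  proof (rule cSUP_least)
    show "cball_along act (F n) x \<epsilon> \<noteq> {}" using centre_in_cball_along[OF e(1)] by auto
    fix y assume y: "y \<in> cball_along act (F n) x \<epsilon>"
    have "\<Phi> (act g y) \<le> \<Phi> (act g x) + \<eta> * m" if g: "g \<in> F n" for g
    proof -
      have "dist (act g x) (act g y) \<le> dist_along act (F n) x y"
        unfolding dist_along_def using g finite_F[of n] by (intro Max_ge) auto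
      also have "\<dots> < d" using y e d(1) by (auto simp: cball_along_def)
      finally have "dist (\<Phi> (act g x)) (\<Phi> (act g y)) < \<eta> * m" by (rule d(2))
      then show ?thesis by (simp add: dist_real_def)
    qed
    then have "sum_along act \<Phi> (F n) y \<le> (\<Sum>g\<in>F n. \<Phi> (act g x) + \<eta> * m)"
      unfolding sum_along_def by (intro sum_mono)
    also have "\<dots> = sum_along act \<Phi> (F n) x + \<eta> * (m * real (card (F n)))"
      by (simp add: sum_along_def sum.distrib)
    also have "\<dots> \<le> sum_along act \<Phi> (F n) x + \<eta> * sum_along act \<Phi> (F n) x"
      using assms by (intro add_left_mono mult_left_mono sum_along_ge m) auto
    finally show "sum_along act \<Phi> (F n) y \<le> (1 + \<eta>) * centre \<epsilon> n x"
      by (simp add: centre_weight_def algebra_simps)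
  qed
  then show ?thesis using d(1) by (intro that[of "d / 2"]) auto
qed

section \<open>Critical values\<close>

lemma packing_crit_centre_antimono:
  assumes "\<epsilon>' \<le> \<epsilon>"
  shows "packing_crit act F centre \<epsilon> H \<le> packing_crit act F centre \<epsilon>' H"
  by (intro packing_crit_mono assms order_refl) (simp add: centre_weight_def)

lemma packing_crit_supw_antimono:
  assumes "0 < \<epsilon>'" "\<epsilon>' \<le> \<epsilon>"
  shows "packing_crit act F supw \<epsilon> H \<le> packing_crit act F supw \<epsilon>' H"
  by (intro packing_crit_mono assms order_refl supw_mono)

lemma packing_crit_centre_le:
  assumes "packing_outer act F centre s \<epsilon> H < \<infinity>"
  shows "packing_crit act F centre \<epsilon> H \<le> ennreal s"
  unfolding packing_crit_def
proof (rule Sup_least, clarify)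
  fix t :: real assume t: "0 < t" "packing_outer act F centre t \<epsilon> H = \<infinity>"
  show "ennreal t \<le> ennreal s"
  proof (rule ccontr)
    assume "\<not> ennreal t \<le> ennreal s"
    then have "s \<le> t" by (meson ennreal_leI linorder_not_le less_imp_le)
    then have "packing_outer act F centre t \<epsilon> H \<le> packing_outer act F centre s \<epsilon> H"
      by (intro packing_outer_mono) (auto intro: mult_right_mono centre_nonneg)
    then show False using t assms by simp
  qed
qed

text \<open>Replacing the centre weight by the supremum weight does not change the limit as the radius
  tends to \<open>0\<close>, because the critical values scale inversely to the weights.\<close>

lemma BSP_dim_set_eq_centre:
  "BSP_dim_set act F \<Phi> H = (SUP \<epsilon>\<in>{0<..}. packing_crit act F centre \<epsilon> H)"
proof -
  have "BSP_dim_set act F \<Phi> H = (SUP \<epsilon>\<in>{0<..}. packing_crit act F supw \<epsilon> H)"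
    (is "_ = ?S")
    unfolding BSP_dim_set_def by (intro Lim_at_right_antimono packing_crit_supw_antimono)
  moreover have "?S \<le> (SUP \<epsilon>\<in>{0<..}. packing_crit act F centre \<epsilon> H)"
    by (intro SUP_subset_mono order_refl packing_crit_mono centre_le_supw) auto
  moreover have "(SUP \<epsilon>\<in>{0<..}. packing_crit act F centre \<epsilon> H) \<le> ?S"
  proof (rule SUP_least, rule ennreal_le_if_le_all_multiples)
    fix \<epsilon> \<eta> :: real assume e: "\<epsilon> \<in> {0<..}" and \<eta>: "0 < \<eta>"
    obtain \<epsilon>\<^sub>0 where \<epsilon>\<^sub>0: "0 < \<epsilon>\<^sub>0"
      "\<And>\<epsilon> n x. 0 < \<epsilon> \<Longrightarrow> \<epsilon> \<le> \<epsilon>\<^sub>0 \<Longrightarrow> supw \<epsilon> n x \<le> (1 + \<eta>) * centre \<epsilon> n x"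
      using supw_le_centre[OF \<eta>] by blast
    define r where "r = min \<epsilon> \<epsilon>\<^sub>0"
    have r: "0 < r" "r \<le> \<epsilon>" "r \<le> \<epsilon>\<^sub>0" using e \<epsilon>\<^sub>0(1) by (auto simp: r_def)
    have "packing_crit act F centre \<epsilon> H \<le> packing_crit act F centre r H"
      by (rule packing_crit_centre_antimono[OF r(2)])
    also have "\<dots> \<le> ennreal (1 + \<eta>) * packing_crit act F supw r H"
      unfolding packing_crit_def[of act F centre]
    proof (rule Sup_least, clarify)
      fix t :: real assume t: "0 < t" "packing_outer act F centre t r H = \<infinity>"
      let ?u = "t / (1 + \<eta>)"
      have u: "0 < ?u" "t = (1 + \<eta>) * ?u" using t \<eta> by auto
      have "packing_outer act F centre t r H \<le> packing_outer act F supw ?u r H"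
      proof (intro packing_outer_mono order_refl)
        fix n x
        have "?u * supw r n x \<le> ?u * ((1 + \<eta>) * centre r n x)"
          by (intro mult_left_mono \<epsilon>\<^sub>0(2) r) (use u in auto)
        then show "?u * supw r n x \<le> t * centre r n x" using \<eta> by simp
      qed
      then have "ennreal ?u \<le> packing_crit act F supw r H"
        unfolding packing_crit_def using u t by (intro Sup_upper) (auto simp: top_unique)
      then have "ennreal (1 + \<eta>) * ennreal ?u \<le> ennreal (1 + \<eta>) * packing_crit act F supw r H"
        by (rule mult_left_mono) simp
      then show "ennreal t \<le> ennreal (1 + \<eta>) * packing_crit act F supw r H"
        using u \<eta> by (simp only: ennreal_mult[symmetric])
    qed
    also have "\<dots> \<le> ennreal (1 + \<eta>) * ?S"
      by (intro mult_left_mono SUP_upper) (use r in auto)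
    finally show "packing_crit act F centre \<epsilon> H \<le> ennreal (1 + \<eta>) * ?S" .
  qed
  ultimately show ?thesis by simp
qed

text \<open>The dichotomy behind the critical value. Raising the exponent from \<open>s\<close> to \<open>t\<close> multiplies
  the term of a ball along \<open>F n\<close> by at most \<open>exp (- (t - s) m |F n|)\<close>, where \<open>m\<close> is a positive
  lower bound of the potential; this tends to \<open>0\<close> because \<open>|F n|\<close> tends to infinity.\<close>

lemma packing_lim_centre_eq_0:
  assumes "packing_lim act F centre s \<epsilon> H < \<infinity>" "s < t"
  shows "packing_lim act F centre t \<epsilon> H = 0"
proof -
  obtain m where m: "0 < m" "\<And>x. m \<le> \<Phi> x" by (rule potential_lower_bound) auto
  obtain N\<^sub>0 where N\<^sub>0: "packing_pre act F centre s N\<^sub>0 \<epsilon> H < \<infinity>"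
    using assms(1) unfolding packing_lim_eq_INF by (auto simp: INF_less_iff)
  define C where "C = packing_pre act F centre s N\<^sub>0 \<epsilon> H"
  have "packing_lim act F centre t \<epsilon> H \<le> ennreal c * C" if c: "0 < c" for c
  proof -
    have "filterlim (\<lambda>n. real (card (F n))) at_top sequentially"
      by (rule filterlim_compose[OF filterlim_real_sequentially card_unbounded])
    then have "\<forall>\<^sub>F n in sequentially. - ln c / ((t - s) * m) \<le> real (card (F n))"
      by (simp add: filterlim_at_top)
    then obtain N\<^sub>1 where N\<^sub>1: "\<And>n. N\<^sub>1 \<le> n \<Longrightarrow> - ln c / ((t - s) * m) \<le> real (card (F n))"
      by (auto simp: eventually_sequentially)
    \<comment> \<open>Beyond this index the gain factor \<open>exp (- (t - s) m |F n|)\<close> is at most \<open>c\<close>.\<close>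
    define N where "N = max N\<^sub>0 N\<^sub>1"
    have factor: "exp (- t * centre \<epsilon> n x) \<le> c * exp (- s * centre \<epsilon> n x)" if n: "N \<le> n" for n x
    proof -
      have "- ln c / ((t - s) * m) \<le> real (card (F n))" using N\<^sub>1 n by (simp add: N_def)
      moreover have "0 < (t - s) * m" using assms(2) m(1) by simp
      ultimately have "- ln c \<le> (t - s) * (m * real (card (F n)))"
        by (simp only: pos_divide_le_eq mult.commute mult.left_commute)
      also have "\<dots> \<le> (t - s) * centre \<epsilon> n x"
        unfolding centre_weight_def using assms(2)
        by (intro mult_left_mono sum_along_ge m) auto
      finally have "- t * centre \<epsilon> n x \<le> ln c + (- s * centre \<epsilon> n x)"
        by (simp add: algebra_simps)
      then have "exp (- t * centre \<epsilon> n x) \<le> exp (ln c + (- s * centre \<epsilon> n x))"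
        by (simp only: exp_le_cancel_iff)
      then show ?thesis using c by (simp only: exp_add exp_ln)
    qed
    have "packing_lim act F centre t \<epsilon> H \<le> packing_pre act F centre t N \<epsilon> H"
      unfolding packing_lim_eq_INF by (rule INF_lower) simp
    also have "\<dots> \<le> ennreal c * packing_pre act F centre s N \<epsilon> H"
      unfolding packing_pre_def[of act F centre t]
    proof (rule Sup_least, clarify)
      fix I :: "nat set" and n x
      assume I: "\<forall>i\<in>I. N \<le> n i \<and> x i \<in> H"
        "disjoint_family_on (\<lambda>i. cball_along act (F (n i)) (x i) \<epsilon>) I"
      have "(\<Sum>\<^sub>\<infinity>i\<in>I. ennreal (exp (- t * centre \<epsilon> (n i) (x i))))
          \<le> (\<Sum>\<^sub>\<infinity>i\<in>I. ennreal c * ennreal (exp (- s * centre \<epsilon> (n i) (x i))))"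
        by (intro infsum_mono nonneg_summable_on_complete)
          (use I c factor in \<open>auto simp: ennreal_mult[symmetric] intro!: ennreal_leI\<close>)
      also have "\<dots> \<le> ennreal c * (\<Sum>\<^sub>\<infinity>i\<in>I. ennreal (exp (- s * centre \<epsilon> (n i) (x i))))"
        by (rule infsum_cmult_le_ennreal)
      also have "\<dots> \<le> ennreal c * packing_pre act F centre s N \<epsilon> H"
        unfolding packing_pre_def using I by (intro mult_left_mono Sup_upper) auto
      finally show "(\<Sum>\<^sub>\<infinity>i\<in>I. ennreal (exp (- t * centre \<epsilon> (n i) (x i))))
          \<le> ennreal c * packing_pre act F centre s N \<epsilon> H" .
    qed
    also have "\<dots> \<le> ennreal c * C"
      unfolding C_def by (rule mult_left_mono, rule packing_pre_mono) (auto simp: N_def)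
    finally show ?thesis .
  qed
  note bound = this
  obtain R where R: "0 \<le> R" "C = ennreal R" using N\<^sub>0 by (cases C) (auto simp: C_def)
  have "packing_lim act F centre t \<epsilon> H \<le> 0"
  proof (rule ennreal_le_epsilon)
    fix e :: real assume e: "0 < e"
    have "packing_lim act F centre t \<epsilon> H \<le> ennreal (e / (R + 1)) * C"
      using e R by (intro bound) auto
    also have "\<dots> = ennreal (e / (R + 1) * R)" using e R by (simp only: R(2) ennreal_mult'')
    also have "\<dots> \<le> ennreal e"
      using e R by (intro ennreal_leI) (simp add: field_simps)
    finally show "packing_lim act F centre t \<epsilon> H \<le> 0 + ennreal e" by simp
  qed
  then show ?thesis by simp
qed

lemma Katok_null_cover:
  assumes "Katok_outer act F \<Phi> \<mu> s \<epsilon> \<delta> < \<infinity>" "s < t"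
  obtains K :: "nat \<Rightarrow> 'x set"
  where "(\<Union>i. K i) \<in> sets borel" "1 - \<delta> \<le> measure \<mu> (\<Union>i. K i)"
    "\<And>i. packing_lim act F centre t \<epsilon> (K i) = 0"
proof -
  obtain K :: "nat \<Rightarrow> 'x set" where K: "(\<Union>i. K i) \<in> sets borel" "1 - \<delta> \<le> measure \<mu> (\<Union>i. K i)"
    "(\<Sum>i. packing_lim act F centre s \<epsilon> (K i)) < \<infinity>"
    using assms(1) unfolding Katok_outer_def by (auto simp: Inf_less_iff)
  have "packing_lim act F centre t \<epsilon> (K i) = 0" for i
    by (rule packing_lim_centre_eq_0[OF ennreal_suminf_lessD[OF K(3)] assms(2)])
  then show ?thesis by (rule that[OF K(1,2)])
qed

lemma Katok_outer_antimono:
  assumes "\<epsilon>' \<le> \<epsilon>" "\<delta>' \<le> \<delta>"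
  shows "Katok_outer act F \<Phi> \<mu> s \<epsilon> \<delta> \<le> Katok_outer act F \<Phi> \<mu> s \<epsilon>' \<delta>'"
  unfolding Katok_outer_def
proof (rule Inf_greatest, clarify)
  fix K :: "nat \<Rightarrow> 'x set"
  assume K: "(\<Union>i. K i) \<in> sets borel" "1 - \<delta>' \<le> measure \<mu> (\<Union>i. K i)"
  have "1 - \<delta> \<le> measure \<mu> (\<Union>i. K i)" using K(2) assms(2) by linarith
  then have "Inf {(\<Sum>i. packing_lim act F centre s \<epsilon> (K i)) | K :: nat \<Rightarrow> 'x set.
            (\<Union>i. K i) \<in> sets borel \<and> 1 - \<delta> \<le> measure \<mu> (\<Union>i. K i)}
      \<le> (\<Sum>i. packing_lim act F centre s \<epsilon> (K i))"
    using K(1) by (intro Inf_lower) auto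
  also have "\<dots> \<le> (\<Sum>i. packing_lim act F centre s \<epsilon>' (K i))"
    by (intro suminf_le packing_lim_mono assms order_refl)
      (auto simp: centre_weight_def)
  finally show "Inf {(\<Sum>i. packing_lim act F centre s \<epsilon> (K i)) | K :: nat \<Rightarrow> 'x set.
            (\<Union>i. K i) \<in> sets borel \<and> 1 - \<delta> \<le> measure \<mu> (\<Union>i. K i)}
      \<le> (\<Sum>i. packing_lim act F centre s \<epsilon>' (K i))" .
qed

lemma Katok_crit_antimono:
  assumes "\<epsilon>' \<le> \<epsilon>" "\<delta>' \<le> \<delta>"
  shows "Katok_crit act F \<Phi> \<mu> \<epsilon> \<delta> \<le> Katok_crit act F \<Phi> \<mu> \<epsilon>' \<delta>'"
  unfolding Katok_crit_def
proof (rule Sup_subset_mono, clarify)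
  fix s :: real assume "0 < s" "Katok_outer act F \<Phi> \<mu> s \<epsilon> \<delta> = \<infinity>"
  then show "\<exists>t. ennreal s = ennreal t \<and> 0 < t \<and> Katok_outer act F \<Phi> \<mu> t \<epsilon>' \<delta>' = \<infinity>"
    using Katok_outer_antimono[OF assms, of \<mu> s] by (intro exI[of _ s]) (simp add: top_unique)
qed

lemma KP_dim_measure_eq_SUP:
  "KP_dim_measure act F \<Phi> \<mu> = (SUP \<epsilon>\<in>{0<..}. SUP \<delta>\<in>{0<..}. Katok_crit act F \<Phi> \<mu> \<epsilon> \<delta>)"
proof -
  have "Lim (at_right 0) (\<lambda>\<delta>. Katok_crit act F \<Phi> \<mu> \<epsilon> \<delta>)
      = (SUP \<delta>\<in>{0<..}. Katok_crit act F \<Phi> \<mu> \<epsilon> \<delta>)" for \<epsilon>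
    by (intro Lim_at_right_antimono Katok_crit_antimono order_refl)
  then show ?thesis
    unfolding KP_dim_measure_def
    by (simp only:) (intro Lim_at_right_antimono SUP_subset_mono Katok_crit_antimono order_refl)
qed

lemma BSP_dim_measure_eq_SUP:
  "BSP_dim_measure act F \<Phi> \<mu> = (SUP \<epsilon>\<in>{0<..}. SUP \<delta>\<in>{0<..}.
     Inf {packing_crit act F centre \<epsilon> H | H. H \<in> sets borel \<and> 1 - \<delta> \<le> measure \<mu> H})"
    (is "_ = (SUP \<epsilon>\<in>_. SUP \<delta>\<in>_. ?A \<epsilon> \<delta>)")
proof -
  have mono: "?A \<epsilon> \<delta> \<le> ?A \<epsilon>' \<delta>'" if "\<epsilon>' \<le> \<epsilon>" "\<delta>' \<le> \<delta>" for \<epsilon> \<epsilon>' \<delta> \<delta>'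
  proof (rule Inf_greatest, clarify)
    fix H :: "'x set" assume H: "H \<in> sets borel" "1 - \<delta>' \<le> measure \<mu> H"
    then have "1 - \<delta> \<le> measure \<mu> H" using that(2) by linarith
    then have "?A \<epsilon> \<delta> \<le> packing_crit act F centre \<epsilon> H" using H(1) by (intro Inf_lower) auto
    also have "\<dots> \<le> packing_crit act F centre \<epsilon>' H"
      by (rule packing_crit_centre_antimono[OF that(1)])
    finally show "?A \<epsilon> \<delta> \<le> packing_crit act F centre \<epsilon>' H" .
  qed
  have "Lim (at_right 0) (?A \<epsilon>) = (SUP \<delta>\<in>{0<..}. ?A \<epsilon> \<delta>)" for \<epsilon>
    by (intro Lim_at_right_antimono mono order_refl)
  then show ?thesis
    unfolding BSP_dim_measure_def
    by (simp only:) (intro Lim_at_right_antimono SUP_subset_mono mono order_refl)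
qed

section \<open>The three dimensions of a measure\<close>

text \<open>A cover of a Borel set \<open>H\<close> restricts to a cover of \<open>H\<close> by subsets of \<open>H\<close>, whose union is
  then exactly \<open>H\<close> and hence Borel, as the definition of the Katok quantity demands.\<close>

lemma Katok_outer_le_packing_outer:
  assumes "H \<in> sets borel" "1 - \<delta> \<le> measure \<mu> H"
  shows "Katok_outer act F \<Phi> \<mu> s \<epsilon> \<delta> \<le> packing_outer act F centre s \<epsilon> H"
  unfolding packing_outer_def
proof (rule Inf_greatest, clarify)
  fix K :: "nat \<Rightarrow> 'x set" assume "H \<subseteq> (\<Union>i. K i)"
  then have U: "(\<Union>i. K i \<inter> H) = H" by blast
  have "Katok_outer act F \<Phi> \<mu> s \<epsilon> \<delta> \<le> (\<Sum>i. packing_lim act F centre s \<epsilon> (K i \<inter> H))"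
    unfolding Katok_outer_def
    by (rule Inf_lower) (use U assms in \<open>auto intro!: exI[of _ "\<lambda>i. K i \<inter> H"]\<close>)
  also have "\<dots> \<le> (\<Sum>i. packing_lim act F centre s \<epsilon> (K i))"
    by (intro suminf_le packing_lim_mono) auto
  finally show "Katok_outer act F \<Phi> \<mu> s \<epsilon> \<delta> \<le> (\<Sum>i. packing_lim act F centre s \<epsilon> (K i))" .
qed

lemma KP_dim_measure_le_BSP_dim_measure: "KP_dim_measure act F \<Phi> \<mu> \<le> BSP_dim_measure act F \<Phi> \<mu>"
  unfolding KP_dim_measure_eq_SUP BSP_dim_measure_eq_SUP
proof (intro SUP_subset_mono order_refl Inf_greatest, clarify)
  fix \<epsilon> \<delta> and H :: "'x set" assume H: "H \<in> sets borel" "1 - \<delta> \<le> measure \<mu> H"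
  show "Katok_crit act F \<Phi> \<mu> \<epsilon> \<delta> \<le> packing_crit act F centre \<epsilon> H"
    unfolding Katok_crit_def packing_crit_def
  proof (rule Sup_subset_mono, clarify)
    fix s :: real assume "0 < s" "Katok_outer act F \<Phi> \<mu> s \<epsilon> \<delta> = \<infinity>"
    then show "\<exists>t. ennreal s = ennreal t \<and> 0 < t \<and> packing_outer act F centre t \<epsilon> H = \<infinity>"
      using Katok_outer_le_packing_outer[OF H, of s \<epsilon>]
      by (intro exI[of _ s]) (simp add: top_unique)
  qed
qed

lemma BSP_dim_measure_le_BSP_dim_set:
  assumes "H \<in> sets borel" "measure \<mu> H = 1"
  shows "BSP_dim_measure act F \<Phi> \<mu> \<le> BSP_dim_set act F \<Phi> H"
  unfolding BSP_dim_measure_eq_SUP BSP_dim_set_eq_centre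
proof (intro SUP_subset_mono order_refl SUP_least Inf_lower)
  fix \<epsilon> \<delta> :: real assume "\<delta> \<in> {0<..}"
  then show "packing_crit act F centre \<epsilon> H \<in>
      {packing_crit act F centre \<epsilon> H |H. H \<in> sets borel \<and> 1 - \<delta> \<le> measure \<mu> H}"
    using assms by auto
qed

text \<open>The substantial inequality. Above the Katok dimension, every radius \<open>\<epsilon>\<close> and every defect
  \<open>\<delta>\<close> admit a countable family of packing-null sets covering all but \<open>\<delta>\<close> of the measure. For
  fixed \<open>\<epsilon>\<close> the union over \<open>\<delta> \<rightarrow> 0\<close> is still countable, hence null, and has full measure; the
  intersection of these unions over \<open>\<epsilon> \<rightarrow> 0\<close> is one set of full measure that is null at every
  radius.\<close>

lemma exists_full_measure_set_above_KP_dim: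
  assumes "prob_space \<mu>" "sets \<mu> = sets borel" "KP_dim_measure act F \<Phi> \<mu> < c"
  shows "\<exists>H. H \<in> sets borel \<and> measure \<mu> H = 1 \<and> BSP_dim_set act F \<Phi> H \<le> c"
proof -
  interpret prob_space \<mu> by fact
  \<comment> \<open>Two levels strictly between the dimension and \<open>c\<close>: finiteness holds at \<open>s\<close>, vanishing at \<open>t\<close>.\<close>
  obtain q where q: "KP_dim_measure act F \<Phi> \<mu> < q" "q < c" using dense[OF assms(3)] by blast
  obtain r where r: "q < r" "r < c" using dense[OF q(2)] by blast
  obtain s where s: "0 \<le> s" "q = ennreal s" using r(1) by (cases q) auto
  obtain t where t: "0 \<le> t" "r = ennreal t" using r(2) by (cases r) auto
  have "0 < ennreal s" using q(1) s(2) by (metis not_gr_zero not_less_zero)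
  then have st: "0 < s" "s < t" using r s t by (simp_all add: ennreal_less_iff)
  have "Katok_outer act F \<Phi> \<mu> s \<epsilon> \<delta> < \<infinity>" if "0 < \<epsilon>" "0 < \<delta>" for \<epsilon> \<delta>
  proof (rule ccontr)
    assume "\<not> Katok_outer act F \<Phi> \<mu> s \<epsilon> \<delta> < \<infinity>"
    then have "Katok_outer act F \<Phi> \<mu> s \<epsilon> \<delta> = \<infinity>" by (simp add: less_top[symmetric])
    then have "ennreal s \<le> Katok_crit act F \<Phi> \<mu> \<epsilon> \<delta>"
      unfolding Katok_crit_def using st by (intro Sup_upper) auto
    also have "\<dots> \<le> KP_dim_measure act F \<Phi> \<mu>"
      unfolding KP_dim_measure_eq_SUP using that by (meson SUP_upper2 SUP_upper greaterThan_iff)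
    finally show False using q s by simp
  qed
  then have "\<exists>K :: nat \<Rightarrow> 'x set. (\<Union>i. K i) \<in> sets borel \<and> 1 - \<delta> \<le> measure \<mu> (\<Union>i. K i) \<and>
      (\<forall>i. packing_lim act F centre t \<epsilon> (K i) = 0)" if "0 < \<epsilon>" "0 < \<delta>" for \<epsilon> \<delta>
    using Katok_null_cover st(2) that by metis
  then obtain K :: "real \<Rightarrow> real \<Rightarrow> nat \<Rightarrow> 'x set" where K:
    "\<And>\<epsilon> \<delta>. 0 < \<epsilon> \<Longrightarrow> 0 < \<delta> \<Longrightarrow> (\<Union>i. K \<epsilon> \<delta> i) \<in> sets borel"
    "\<And>\<epsilon> \<delta>. 0 < \<epsilon> \<Longrightarrow> 0 < \<delta> \<Longrightarrow> 1 - \<delta> \<le> measure \<mu> (\<Union>i. K \<epsilon> \<delta> i)"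
    "\<And>\<epsilon> \<delta> i. 0 < \<epsilon> \<Longrightarrow> 0 < \<delta> \<Longrightarrow> packing_lim act F centre t \<epsilon> (K \<epsilon> \<delta> i) = 0"
    by metis
  define \<rho> :: "nat \<Rightarrow> real" where "\<rho> j = 1 / real (Suc j)" for j
  have \<rho>: "0 < \<rho> j" for j by (simp add: \<rho>_def)
  define U where "U j = (\<Union>k i. K (\<rho> j) (\<rho> k) i)" for j
  define H where "H = (\<Inter>j. U j)"
  have U: "U j \<in> sets borel" for j
    unfolding U_def by (intro sets.countable_UN image_subsetI K(1) \<rho>)
  have "measure \<mu> (U j) = 1" for j
  proof (rule antisym[OF prob_le_1], rule field_le_epsilon)
    fix e :: real assume "0 < e"
    then obtain k where k: "\<rho> k < e" unfolding \<rho>_def using nat_approx_posE by blast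
    have "1 - \<rho> k \<le> measure \<mu> (\<Union>i. K (\<rho> j) (\<rho> k) i)" by (intro K(2) \<rho>)
    also have "\<dots> \<le> measure \<mu> (U j)"
      using U[of j] assms(2) by (intro finite_measure_mono) (auto simp: U_def)
    finally show "1 \<le> measure \<mu> (U j) + e" using k by linarith
  qed
  then have "AE x in \<mu>. x \<in> U j" for j
    using U[of j] assms(2) by (subst prob_eq_1[symmetric]) auto
  then have "AE x in \<mu>. x \<in> H" unfolding H_def by (simp add: AE_all_countable)
  moreover have H: "H \<in> sets borel" unfolding H_def using U by (intro sets.countable_INT) auto
  ultimately have full: "measure \<mu> H = 1" using assms(2) by (subst prob_eq_1) auto
  have null: "packing_outer act F centre t (\<rho> j) H = 0" for j
  proof -
    define L where "L = case_prod (\<lambda>k. K (\<rho> j) (\<rho> k)) \<circ> prod_decode"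
    have "H \<subseteq> (\<Union>p. L p)"
    proof
      fix x assume "x \<in> H"
      then obtain k i where "x \<in> K (\<rho> j) (\<rho> k) i" unfolding H_def U_def by blast
      then have "x \<in> L (prod_encode (k, i))" by (simp add: L_def)
      then show "x \<in> (\<Union>p. L p)" by blast
    qed
    then have "packing_outer act F centre t (\<rho> j) H
        \<le> (\<Sum>p. packing_lim act F centre t (\<rho> j) (L p))"
      unfolding packing_outer_def by (intro Inf_lower) auto
    also have "\<dots> = 0"
      by (simp add: L_def case_prod_beta K(3) \<rho>)
    finally show ?thesis by simp
  qed
  have "BSP_dim_set act F \<Phi> H \<le> c"
    unfolding BSP_dim_set_eq_centre
  proof (rule SUP_least)
    fix \<epsilon> :: real assume "\<epsilon> \<in> {0<..}"
    then obtain j where "\<rho> j < \<epsilon>" unfolding \<rho>_def using nat_approx_posE by auto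
    then have "packing_crit act F centre \<epsilon> H \<le> packing_crit act F centre (\<rho> j) H"
      by (intro packing_crit_centre_antimono) simp
    also have "\<dots> \<le> ennreal t" by (rule packing_crit_centre_le) (simp add: null)
    also have "\<dots> \<le> c" using r(2) t(2) by simp
    finally show "packing_crit act F centre \<epsilon> H \<le> c" .
  qed
  then show ?thesis using H full by blast
qed

end

theorem theorem1p4:
  fixes G :: "('g, 'm) monoid_scheme"
    and act :: "'g \<Rightarrow> 'x::metric_space \<Rightarrow> 'x"
    and F :: "nat \<Rightarrow> 'g set"
    and \<Phi> :: "'x \<Rightarrow> real"
    and \<mu> :: "'x measure"
  assumes "group G" and "countable (carrier G)" and "infinite (carrier G)" and "amenable G"
    and "compact (UNIV :: 'x set)"
    and "group_action G (UNIV :: 'x set) act"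
    and "\<And>g. g \<in> carrier G \<Longrightarrow> continuous_on UNIV (act g)"
    and "Folner_sequence G F"
    and "mono (\<lambda>n. card (F n))"
    and "filterlim (\<lambda>n. card (F n)) at_top sequentially"
    and "continuous_on UNIV \<Phi>" and "\<And>x. 0 < \<Phi> x"
    and "prob_space \<mu>" and "sets \<mu> = sets borel"
  shows "BSP_dim_measure act F \<Phi> \<mu> = KP_dim_measure act F \<Phi> \<mu> \<and>
         KP_dim_measure act F \<Phi> \<mu> =
           Inf {BSP_dim_set act F \<Phi> H | H. H \<in> sets borel \<and> measure \<mu> H = 1}"
    (is "?B = ?K \<and> ?K = ?I")
proof -
  interpret positive_potential act F \<Phi>
    using assms by unfold_locales (auto simp: Folner_sequence_def)
  have "?K \<le> ?B" by (rule KP_dim_measure_le_BSP_dim_measure)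
  moreover have "?B \<le> ?I"
    by (rule Inf_greatest) (use BSP_dim_measure_le_BSP_dim_set in blast)
  moreover have "?I \<le> ?K"
  proof (rule dense_ge)
    fix c assume "?K < c"
    then obtain H where H: "H \<in> sets borel" "measure \<mu> H = 1" "BSP_dim_set act F \<Phi> H \<le> c"
      using exists_full_measure_set_above_KP_dim assms(13,14) by blast
    then show "?I \<le> c" by (intro Inf_lower2[of "BSP_dim_set act F \<Phi> H"]) auto
  qed
  ultimately show ?thesis by (intro conjI antisym) (blast intro: order_trans)+
qed

end
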